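(* For every $b>0$ and every $\alpha\in(0,1)$ there exists $m\in\mathbb{N}$ such that, if $K(\cdot)$ is the probability density on $\mathbb{N}$ given by $$K(n):=\begin{cases}\dfrac{\Gamma(n-m-\alpha)}{-\Gamma(-\alpha)\,(n-m)!} & \text{for } n=m+1,m+2,\ldots,\\[2mm] 0 & \text{for } n=1,2,\ldots,m,\end{cases}$$ then there exists $z_0\in\mathbb{C}$ with $1<|z_0|<\exp(b)$ and $\hat{K_b}(z_0)=1$.
   Context: $\mathbb{N}=\{1,2,\ldots\}$. $\Gamma(\cdot)$ is the Gamma function, $\Gamma(z)=\int_0^\infty t^{z-1}\exp(-t)\,\mathrm{d}t$ for $\Re(z)>0$, extended meromorphically to $\mathbb{C}$ (so that $\Gamma(z+1)=z\Gamma(z)$ for $z\notin\{0,-1,-2,\ldots\}$). Given a probability density $K$ on $\mathbb{N}$ and $b\ge0$, set $K_b(n):=c(b)K(n)\exp(-bn)$ for $n\in\mathbb{N}$, with $c(b):=1/\sum_{n\ge1}K(n)\exp(-bn)$, and define its $z$-transform $\hat{K_b}(z):=\sum_{n\ge1}K_b(n)z^n$, which converges absolutely for complex $z$ with $|z|\le\exp(b)$. *)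

theory Defs
  imports "HOL-Analysis.Analysis"
begin

text \<open>Densities on \<open>{1, 2, \<dots>}\<close> are functions \<open>nat \<Rightarrow> real\<close> whose value at \<open>0\<close> is irrelevant:
  every sum below ranges over \<open>{1..}\<close>.\<close>

definition prob_density :: "(nat \<Rightarrow> real) \<Rightarrow> bool" where
  "prob_density K \<longleftrightarrow> (\<forall>n\<ge>1. K n \<ge> 0) \<and> (K has_sum 1) {1..}"

definition tilt_const :: "(nat \<Rightarrow> real) \<Rightarrow> real \<Rightarrow> real" where
  "tilt_const K b = 1 / (\<Sum>\<^sub>\<infinity>n\<in>{1..}. K n * exp (- b * real n))"

definition tilted :: "(nat \<Rightarrow> real) \<Rightarrow> real \<Rightarrow> nat \<Rightarrow> real" where
  "tilted K b n = tilt_const K b * K n * exp (- b * real n)"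

definition z_transform :: "(nat \<Rightarrow> real) \<Rightarrow> complex \<Rightarrow> complex" where
  "z_transform f z = (\<Sum>\<^sub>\<infinity>n\<in>{1..}. of_real (f n) * z ^ n)"

definition K_shift :: "real \<Rightarrow> nat \<Rightarrow> nat \<Rightarrow> real" where
  "K_shift \<alpha> m n =
     (if n \<ge> m + 1 then Gamma (real n - real m - \<alpha>) / (- Gamma (- \<alpha>) * fact (n - m)) else 0)"

end

theory Submission
  imports Defs
begin

text \<open>Up to normalisation the transform is \<open>z ^ m * G z\<close>, where \<open>G\<close> is a power series with
  nonnegative coefficients that does not depend on \<open>m\<close> and satisfies \<open>G 1 = 1\<close>. Writing \<open>z = exp w\<close>,
  a solution of \<open>m w + Ln (G (exp w)) = 2 \<pi> \<i>\<close> is a fixed point of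
  \<open>w \<mapsto> (2 \<pi> \<i> - Ln (G (exp w))) / m\<close>, which for large \<open>m\<close> maps a small ball around \<open>0\<close> into
  itself, so Brouwer's theorem provides one; it gives a solution \<open>z \<noteq> 1\<close> as close to \<open>1\<close> as desired.
  Since the coefficients are nonnegative and aperiodic, \<open>z = 1\<close> is the only solution in the closed
  unit disc, hence \<open>1 < norm z\<close>.\<close>

section \<open>Nontrivial solutions near 1\<close>

lemma power_times_eq_1_near_1:
  fixes g :: "complex \<Rightarrow> complex"
  assumes U: "open U" "1 \<in> U" and g: "continuous_on U g" "g 1 = 1"
  obtains m :: nat and z where "m \<ge> 1" "z \<in> U" "z \<noteq> 1" "z ^ m * g z = 1"
proof -
  \<comment> \<open>Positive real part keeps \<open>g\<close> away from 0 and from the branch cut of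
    \<open>Ln\<close>, so that \<open>Ln (g (exp w))\<close> is continuous.\<close>
  define V where "V = U \<inter> g -` {z. Re z > 0}"
  have "open V"
    unfolding V_def by (intro continuous_open_preimage g U open_halfspace_Re_gt)
  then have "open (exp -` V :: complex set)"
    by (intro open_vimage continuous_intros)
  moreover have "0 \<in> (exp -` V :: complex set)"
    using U g by (simp add: V_def)
  ultimately obtain e where e: "e > 0" "cball 0 e \<subseteq> (exp -` V :: complex set)"
    unfolding open_contains_cball by blast
  \<comment> \<open>The cap 1 is below \<open>pi\<close>; it makes \<open>Ln (exp w) = w\<close> on
    the ball, which is needed to exclude \<open>exp w = 1\<close>.\<close>
  define d where "d = min e 1"
  have d: "0 < d" "d \<le> 1"
    using e by (auto simp: d_def)
  have V: "exp w \<in> V" if "w \<in> cball 0 d" for w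
    using that e by (force simp: d_def)
  define h where "h w = 2 * of_real pi * \<i> - Ln (g (exp w))" for w
  have cont: "continuous_on (cball 0 d) h"
    unfolding h_def
    by (intro continuous_intros continuous_on_Ln continuous_on_compose2[OF g(1)])
      (use V in \<open>force simp: V_def complex_nonpos_Reals_iff\<close>)+
  then have "bounded (h ` cball 0 d)"
    by (intro compact_imp_bounded compact_continuous_image) auto
  then obtain B where B: "norm (h w) \<le> B" if "w \<in> cball 0 d" for w
    unfolding bounded_iff by blast
  \<comment> \<open>Beyond \<open>B / d\<close>, division by \<open>m\<close> shrinks the image of
    \<open>h\<close> into the ball of radius \<open>d\<close>; beyond 1, \<open>m\<close> is
    nonzero.\<close>
  obtain m :: nat where m: "real m > max 1 (B / d)"
    using reals_Archimedean2 by blast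
  then have m1: "m \<ge> 1"
    by simp
  have "(\<lambda>w. h w / of_nat m) \<in> cball 0 d \<rightarrow> cball 0 d"
  proof
    fix w :: complex
    assume w: "w \<in> cball 0 d"
    have "norm (h w / of_nat m) \<le> B / m"
      using B[OF w] by (simp add: norm_divide divide_right_mono)
    also have "\<dots> \<le> d"
      using m d by (simp add: field_simps)
    finally show "h w / of_nat m \<in> cball 0 d"
      by simp
  qed
  moreover have "continuous_on (cball 0 d) (\<lambda>w. h w / of_nat m)"
    using m1 by (intro continuous_intros cont) auto
  ultimately obtain w where w: "w \<in> cball 0 d" "h w / of_nat m = w"
    using brouwer[of "cball 0 d" "\<lambda>w. h w / of_nat m"] d by auto
  have hw: "of_nat m * w = 2 * of_real pi * \<i> - Ln (g (exp w))"
    using w(2) m1 by (auto simp: field_simps h_def)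
  have nz: "g (exp w) \<noteq> 0"
    using V[OF w(1)] by (auto simp: V_def)
  show thesis
  proof
    show "m \<ge> 1"
      by fact
    show "exp w \<in> U"
      using V[OF w(1)] by (simp add: V_def)
    have "exp w ^ m = 1 / g (exp w)"
      using nz by (simp add: exp_of_nat_mult[symmetric] hw exp_diff)
    then show "exp w ^ m * g (exp w) = 1"
      using nz by simp
    show "exp w \<noteq> 1"
    proof
      assume "exp w = 1"
      moreover have "\<bar>Im w\<bar> < pi"
        using abs_Im_le_cmod[of w] w(1) d pi_gt3 by simp
      then have "Ln (exp w) = w"
        by (intro Ln_exp) auto
      \<comment> \<open>The summand \<open>2 * of_real pi * \<i>\<close> rules this out: at
        \<open>w = 0\<close> the logarithm of \<open>g 1 = 1\<close> vanishes, so the fixed point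
        equation would read 0 = 2 pi i.\<close>
      ultimately have "w = 0"
        by simp
      then show False
        using hw g(2) by simp
    qed
  qed
qed

section \<open>Uniqueness in the closed unit disc\<close>

text \<open>This is the equality case of the triangle inequality. Taking real parts, the nonnegative
  terms \<open>a k * (1 - Re (z ^ (m + k)))\<close> sum to 0, so each vanishes and
  \<open>z ^ (m + k) = 1\<close> wherever \<open>a k > 0\<close>. Two consecutive such exponents
  leave only \<open>z = 1\<close>.\<close>

lemma nonneg_power_series_eq_sum_imp_1:
  fixes a :: "nat \<Rightarrow> real" and z :: complex
  assumes nonneg: "\<And>k. a k \<ge> 0" and summ: "summable a"
    and pos: "a j > 0" "a (Suc j) > 0"
    and z: "norm z \<le> 1" and eq: "z ^ m * (\<Sum>k. of_real (a k) * z ^ k) = of_real (\<Sum>k. a k)"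
  shows "z = 1"
proof -
  have zk: "norm (z ^ k) \<le> 1" for k
    using z by (simp add: norm_power power_le_one)
  have "summable (\<lambda>k. of_real (a k) * z ^ k)"
  proof (rule summable_comparison_test'[OF summ])
    show "norm (of_real (a k) * z ^ k) \<le> a k" for k
      using mult_left_mono[OF zk[of k] nonneg[of k]] nonneg[of k] by (simp add: norm_mult)
  qed
  then have "(\<lambda>k. z ^ m * (of_real (a k) * z ^ k)) sums of_real (\<Sum>k. a k)"
    unfolding eq[symmetric] by (intro sums_mult summable_sums)
  then have "(\<lambda>k. Re (z ^ m * (of_real (a k) * z ^ k))) sums Re (of_real (\<Sum>k. a k))"
    by (rule sums_Re)
  moreover have "Re (z ^ m * (of_real (a k) * z ^ k)) = a k * Re (z ^ (m + k))" for k
  proof -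
    have "z ^ m * (of_real (a k) * z ^ k) = a k *\<^sub>R z ^ (m + k)"
      by (simp add: power_add scaleR_conv_of_real)
    then show ?thesis
      by (simp only: scaleR_complex.sel)
  qed
  ultimately have "(\<lambda>k. a k * Re (z ^ (m + k))) sums (\<Sum>k. a k)"
    by (simp only: Re_complex_of_real)
  then have "(\<lambda>k. a k * (1 - Re (z ^ (m + k)))) sums 0"
    using sums_diff[OF summable_sums[OF summ]] by (fastforce simp: algebra_simps)
  moreover have "a k * (1 - Re (z ^ (m + k))) \<ge> 0" for k
    using nonneg[of k] complex_Re_le_cmod[of "z ^ (m + k)"] zk[of "m + k"] by simp
  ultimately have zero: "a k * (1 - Re (z ^ (m + k))) = 0" for k
    using suminf_eq_zero_iff[of "\<lambda>k. a k * (1 - Re (z ^ (m + k)))"] by (auto simp: sums_iff)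
  have one: "z ^ (m + k) = 1" if "a k > 0" for k
  proof -
    have re: "Re (z ^ (m + k)) = 1"
      using zero[of k] that by simp
    moreover have "(Re (z ^ (m + k)))\<^sup>2 + (Im (z ^ (m + k)))\<^sup>2 \<le> 1"
      using zk[of "m + k"] by (simp add: cmod_power2[symmetric] power_le_one)
    ultimately show ?thesis
      by (simp add: complex_eq_iff)
  qed
  show "z = 1"
    using one[OF pos(1)] one[OF pos(2)] by simp
qed

section \<open>The unshifted density\<close>

context
  fixes \<alpha> :: real
  assumes \<alpha>: "0 < \<alpha>" "\<alpha> < 1"
begin

text \<open>The functional equation moves the argument to the positive axis, which reveals the sign
  of the normalising factor of the density.\<close>

lemma Gamma_uminus_eq: "Gamma (- \<alpha>) = - Gamma (1 - \<alpha>) / \<alpha>"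
proof -
  have "- \<alpha> \<notin> \<int>\<^sub>\<le>\<^sub>0"
  proof
    assume "- \<alpha> \<in> \<int>\<^sub>\<le>\<^sub>0"
    then obtain n :: nat where "\<alpha> = real n"
      by (auto elim: nonpos_Ints_cases')
    then show False
      using \<alpha> by simp
  qed
  then show ?thesis
    using Gamma_plus1[of "- \<alpha>"] \<alpha> by (simp add: field_simps)
qed

lemma K_shift_0_pos:
  assumes "k \<ge> 1"
  shows "K_shift \<alpha> 0 k > 0"
proof -
  have "Gamma (1 - \<alpha>) > 0" "Gamma (real k - \<alpha>) > 0"
    using \<alpha> assms by (auto intro!: Gamma_real_pos)
  then show ?thesis
    using \<alpha> assms by (simp add: K_shift_def Gamma_uminus_eq)
qed

lemma K_shift_0_nonneg: "K_shift \<alpha> 0 k \<ge> 0"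
  using K_shift_0_pos[of k] by (cases "k = 0") (auto simp: K_shift_def)

text \<open>The tail sums of the density are the binomial coefficients \<open>(k - \<alpha>) gchoose k\<close>.\<close>

lemma K_shift_0_sums: "K_shift \<alpha> 0 sums 1"
proof -
  define T where "T k = (real k - \<alpha>) gchoose k" for k
  have T_Gamma: "T k = Gamma (real k + 1 - \<alpha>) / (fact k * Gamma (1 - \<alpha>))" for k
  proof -
    have "real k - \<alpha> + 1 \<notin> \<int>\<^sub>\<le>\<^sub>0"
      using \<alpha> by (auto dest!: nonpos_Ints_nonpos)
    then show ?thesis
      unfolding T_def by (subst gbinomial_Gamma) (simp_all add: algebra_simps)
  qed
  \<comment> \<open>The tails decay like \<open>k powr - \<alpha>\<close>: rescaled by the inverse
    power they have a finite limit, by the Gamma asymptotics of binomial coefficients.\<close>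
  have "(\<lambda>k. T k * exp (\<alpha> * ln (real k)) * exp (- \<alpha> * ln (real k))) \<longlonglongrightarrow> rGamma (- \<alpha> + 1) * 0"
  proof (rule tendsto_mult)
    show "(\<lambda>k. T k * exp (\<alpha> * ln (real k))) \<longlonglongrightarrow> rGamma (- \<alpha> + 1)"
      using Gamma_gbinomial[of "- \<alpha>"] by (simp add: T_def)
    show "(\<lambda>k. exp (- \<alpha> * ln (real k))) \<longlonglongrightarrow> 0"
    proof (rule Lim_transform_eventually)
      show "(\<lambda>k. real k powr - \<alpha>) \<longlonglongrightarrow> 0"
        using \<alpha> by (intro tendsto_neg_powr filterlim_real_sequentially) auto
      show "eventually (\<lambda>k. real k powr - \<alpha> = exp (- \<alpha> * ln (real k))) sequentially"
        using eventually_gt_at_top[of 0] by eventually_elim (simp add: powr_def)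
    qed
  qed
  then have "T \<longlonglongrightarrow> 0"
    by (simp add: mult.assoc flip: exp_add)
  then have "(\<lambda>k. T k - T (Suc k)) sums (T 0 - 0)"
    by (rule telescope_sums')
  moreover have "T k - T (Suc k) = K_shift \<alpha> 0 (Suc k)" for k
  proof -
    \<comment> \<open>By the functional equation both tails and the density are rational multiples
      of the same Gamma value \<open>G\<close>; the claim becomes
      \<open>x - (x - \<alpha>) = \<alpha>\<close>.\<close>
    define x and G where "x = real k + 1" and "G = Gamma (x - \<alpha>)"
    have "x - \<alpha> \<notin> \<int>\<^sub>\<le>\<^sub>0"
      using \<alpha> by (auto simp: x_def dest!: nonpos_Ints_nonpos)
    then have "Gamma (x + 1 - \<alpha>) = (x - \<alpha>) * G"
      using Gamma_plus1[of "x - \<alpha>"] by (simp add: G_def algebra_simps)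
    then have "T (Suc k) = (x - \<alpha>) * G / (x * fact k * Gamma (1 - \<alpha>))"
      by (simp add: T_Gamma x_def add_ac)
    moreover have "T k = G / (fact k * Gamma (1 - \<alpha>))"
      by (simp add: T_Gamma G_def x_def)
    moreover have "K_shift \<alpha> 0 (Suc k) = \<alpha> * G / (x * fact k * Gamma (1 - \<alpha>))"
      using \<alpha> by (simp add: K_shift_def Gamma_uminus_eq G_def x_def ac_simps)
    moreover have "Gamma (1 - \<alpha>) > 0" "x > 0"
      using \<alpha> by (auto simp: x_def intro!: Gamma_real_pos)
    ultimately show ?thesis
      by (simp only:) (simp add: field_simps)
  qed
  ultimately have "(\<lambda>k. K_shift \<alpha> 0 (Suc k)) sums 1"
    by (simp add: T_def)
  then show ?thesis
    by (subst (asm) sums_Suc_iff) (simp add: K_shift_def)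
qed

end

section \<open>The transform of the tilted shifted density\<close>

text \<open>The two index sets differ only at points \<open>n \<le> m\<close>, where
  \<open>f\<close> vanishes. This includes \<open>n = 0\<close>, which lies in the shifted range
  when \<open>m = 0\<close>.\<close>

lemma has_sum_shift:
  fixes f :: "nat \<Rightarrow> 'a :: {comm_monoid_add, topological_space}"
  assumes "\<And>n. n \<le> m \<Longrightarrow> f n = 0"
  shows "(f has_sum S) {1..} \<longleftrightarrow> ((\<lambda>k. f (k + m)) has_sum S) UNIV"
proof -
  have "(f has_sum S) {1..} \<longleftrightarrow> (f has_sum S) (range (\<lambda>k. k + m))"
  proof (rule has_sum_cong_neutral)
    fix n assume "n \<in> {1..} - range (\<lambda>k. k + m)"
    then have "n \<le> m"
      by (metis DiffD2 le_add_diff_inverse2 nat_le_linear rangeI)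
    then show "f n = 0"
      by (rule assms)
  next
    fix n assume "n \<in> range (\<lambda>k. k + m) - {1..}"
    then show "f n = 0"
      by (intro assms) auto
  qed auto
  also have "\<dots> \<longleftrightarrow> ((\<lambda>k. f (k + m)) has_sum S) UNIV"
    by (subst has_sum_reindex) (auto simp: inj_on_def o_def)
  finally show ?thesis .
qed

lemma K_shift_add: "K_shift \<alpha> m (k + m) = K_shift \<alpha> 0 k"
  by (simp add: K_shift_def)

lemma K_shift_eq_0: "n \<le> m \<Longrightarrow> K_shift \<alpha> m n = 0"
  by (simp add: K_shift_def)

lemma prob_density_K_shift:
  assumes "0 < \<alpha>" "\<alpha> < 1"
  shows "prob_density (K_shift \<alpha> m)"
proof -
  have "K_shift \<alpha> m n \<ge> 0" for n
    using K_shift_0_nonneg[OF assms, of "n - m"] K_shift_add[of \<alpha> m "n - m"]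
    by (cases "n \<le> m") (auto simp: K_shift_eq_0)
  moreover have "(K_shift \<alpha> 0 has_sum 1) UNIV"
    by (intro sums_nonneg_imp_has_sum K_shift_0_sums K_shift_0_nonneg assms)
  then have "(K_shift \<alpha> m has_sum 1) {1..}"
    by (subst has_sum_shift[of m]) (auto simp: K_shift_add K_shift_eq_0)
  ultimately show ?thesis
    by (simp add: prob_density_def)
qed

text \<open>Shifting by \<open>m\<close> multiplies the tilted weights by
  \<open>exp (- b * real m)\<close>, and the normalising constant cancels this factor. Only
  \<open>z ^ m\<close> still depends on \<open>m\<close>.\<close>

lemma z_transform_tilted_K_shift:
  fixes \<alpha> b :: real and z :: complex and m :: nat
  defines "a \<equiv> \<lambda>k. K_shift \<alpha> 0 k * exp (- b * real k)"
  assumes \<alpha>: "0 < \<alpha>" "\<alpha> < 1" and b: "b \<ge> 0" and z: "norm z \<le> exp b"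
  shows "z_transform (tilted (K_shift \<alpha> m) b) z =
    z ^ m * (\<Sum>k. of_real (a k) * z ^ k) / of_real (\<Sum>k. a k)"
proof -
  let ?p = "K_shift \<alpha> 0"
  have p: "?p k \<ge> 0" "summable ?p" for k
    using K_shift_0_nonneg[OF \<alpha>] K_shift_0_sums[OF \<alpha>] by (auto simp: sums_iff)
  have a_nonneg: "a k \<ge> 0" for k
    using p by (simp add: a_def)
  \<comment> \<open>On the boundary circle of radius \<open>exp b\<close> the power undoes the tilt,
    so the summable untilted density dominates on the whole closed disc.\<close>
  have "a k * norm z ^ k \<le> ?p k" for k
  proof -
    have "a k * norm z ^ k \<le> a k * exp b ^ k"
      using z a_nonneg by (intro mult_left_mono power_mono) auto
    also have "\<dots> = ?p k"
      by (simp add: a_def mult.assoc mult.commute flip: exp_of_nat_mult exp_add)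
    finally show ?thesis .
  qed
  then have norm_summ: "summable (\<lambda>k. norm (of_real (a k) * z ^ k))"
    by (intro summable_comparison_test'[OF p(2)]) (auto simp: norm_mult norm_power a_nonneg)
  have F: "((\<lambda>k. of_real (a k) * z ^ k) has_sum (\<Sum>k. of_real (a k) * z ^ k)) UNIV"
    using norm_summ
    by (rule norm_summable_imp_has_sum[OF _ summable_sums[OF summable_norm_cancel[OF norm_summ]]])
  have "a k \<le> ?p k" for k
    using p b by (simp add: a_def mult_left_le)
  then have "summable a"
    by (intro summable_comparison_test'[OF p(2)]) (auto simp: a_nonneg)
  then have "(a has_sum (\<Sum>k. a k)) UNIV"
    by (intro sums_nonneg_imp_has_sum summable_sums a_nonneg)
  then have "((\<lambda>k. exp (- b * real m) * a k) has_sum exp (- b * real m) * (\<Sum>k. a k)) UNIV"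
    by (rule has_sum_cmult_right)
  then have "((\<lambda>n. K_shift \<alpha> m n * exp (- b * real n)) has_sum exp (- b * real m) * (\<Sum>k. a k)) {1..}"
    by (subst has_sum_shift[of m])
      (simp_all add: K_shift_eq_0 K_shift_add a_def algebra_simps flip: exp_add)
  then have c: "tilt_const (K_shift \<alpha> m) b = 1 / (exp (- b * real m) * (\<Sum>k. a k))"
    by (simp add: tilt_const_def infsumI)
  have t: "tilted (K_shift \<alpha> m) b (k + m) = a k / (\<Sum>k. a k)" for k
    by (simp add: tilted_def c K_shift_add a_def distrib_left exp_add exp_minus field_simps exp_diff)
  have "((\<lambda>k. z ^ m / of_real (\<Sum>k. a k) * (of_real (a k) * z ^ k)) has_sum
      z ^ m / of_real (\<Sum>k. a k) * (\<Sum>k. of_real (a k) * z ^ k)) UNIV"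
    using F by (rule has_sum_cmult_right)
  then have "((\<lambda>n. of_real (tilted (K_shift \<alpha> m) b n) * z ^ n) has_sum
      z ^ m / of_real (\<Sum>k. a k) * (\<Sum>k. of_real (a k) * z ^ k)) {1..}"
    by (subst has_sum_shift[of m])
      (simp_all add: t power_add mult_ac, simp add: tilted_def K_shift_eq_0)
  then show ?thesis
    by (simp add: z_transform_def infsumI)
qed

section \<open>Combining existence and uniqueness\<close>

theorem proposition4p1:
  fixes b \<alpha> :: real
  assumes "b > 0" and "0 < \<alpha>" and "\<alpha> < 1"
  shows "\<exists>m::nat. m \<ge> 1 \<and> prob_density (K_shift \<alpha> m) \<and>
           (\<exists>z\<^sub>0::complex. 1 < norm z\<^sub>0 \<and> norm z\<^sub>0 < exp b \<and>
              z_transform (tilted (K_shift \<alpha> m) b) z\<^sub>0 = 1)"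
proof -
  note \<alpha> = assms(2,3)
  let ?p = "K_shift \<alpha> 0"
  define a where "a k = ?p k * exp (- b * real k)" for k
  define S where "S = (\<Sum>k. a k)"
  define G where "G z = (\<Sum>k. of_real (a k) * z ^ k)" for z :: complex
  have p: "?p k \<ge> 0" "summable ?p" for k
    using K_shift_0_nonneg[OF \<alpha>] K_shift_0_sums[OF \<alpha>] by (auto simp: sums_iff)
  have a_nonneg: "a k \<ge> 0" for k
    using p by (simp add: a_def)
  have a_pos: "a k > 0" if "k \<ge> 1" for k
    using K_shift_0_pos[OF \<alpha> that] by (simp add: a_def)
  have "a k \<le> ?p k" for k
    using p assms(1) by (simp add: a_def mult_left_le)
  then have summ: "summable a"
    by (intro summable_comparison_test'[OF p(2)]) (auto simp: a_nonneg)
  then have S: "S > 0"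
    unfolding S_def using a_pos[of 1] by (intro suminf_pos2[of _ 1] a_nonneg) auto
  have G1: "G 1 = of_real S"
    using summ by (simp add: G_def S_def suminf_of_real)
  \<comment> \<open>Convergence at the single point \<open>exp b\<close> yields continuity of
    \<open>G\<close> on the open disc of that radius, which contains 1 because
    \<open>b > 0\<close>.\<close>
  have "summable (\<lambda>k. of_real (a k) * (of_real (exp b) :: complex) ^ k)"
  proof -
    have "complex_of_real (a k) * of_real (exp b) ^ k = of_real (?p k)" for k
      by (simp add: a_def mult.assoc mult.commute
          flip: of_real_mult of_real_power exp_of_nat_mult exp_add)
    then show ?thesis
      using p(2) by (simp add: summable_of_real)
  qed
  then have "isCont G z" if "norm z < exp b" for z
    unfolding G_def by (rule isCont_powser) (use that in simp)
  then have "continuous_on (ball 0 (exp b)) (\<lambda>z. G z / of_real S)"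
    using S by (intro continuous_intros continuous_at_imp_continuous_on) auto
  then obtain m :: nat and z where m: "m \<ge> 1" and
    z: "z \<in> ball 0 (exp b)" "z \<noteq> 1" "z ^ m * (G z / of_real S) = 1"
    using power_times_eq_1_near_1[of "ball 0 (exp b)" "\<lambda>z. G z / of_real S"] G1 S assms(1) by auto
  have "z ^ m * G z = of_real S"
    using z(3) S by (simp add: field_simps)
  \<comment> \<open>Otherwise \<open>z\<close> would lie in the closed unit disc and equal 1. The
    consecutive positive coefficients are \<open>a 1\<close> and \<open>a 2\<close>, since
    \<open>a 0 = 0\<close>.\<close>
  then have "1 < norm z"
    using nonneg_power_series_eq_sum_imp_1[of a 1 z m] a_nonneg summ a_pos z(2)
    by (force simp: G_def S_def)
  moreover have "z_transform (tilted (K_shift \<alpha> m) b) z = 1"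
    using z_transform_tilted_K_shift[OF \<alpha>, of b z m] assms(1) z by (simp add: G_def S_def a_def)
  ultimately show ?thesis
    using m z(1) prob_density_K_shift[OF \<alpha>] by auto
qed

end
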